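(* Let $L\in\mathbb{R}^{n\times n}$ be irreducible with zero column sums, spectral abscissa $0$ with $0$ a simple eigenvalue, and eventually exponentially positive, with stationary density $\boldsymbol p^\infty$ and spectral projector $\Pi$ for the eigenvalue $0$. Let $r$ be an A-acceptable rational function with real coefficients, $r(0)=1$ and finite $r(\infty)$, whose poles avoid $\operatorname{spec}(\gamma L)$ for all $\gamma>0$, and let $M_\infty=\Pi+r(\infty)(\mathcal I-\Pi)$, which is the limit $\lim_{\gamma\to\infty}r(\gamma L)$. (a) If $0\le r(\infty)<1$, then $M_\infty>0$, and there exists $\gamma_r<\infty$ such that $r(\gamma L)>0$ for all $\gamma\ge\gamma_r$. (b) If $r(\infty)<0$, then $M_\infty$ has a negative diagonal entry $(M_\infty)_{ii}<0$ at every index $i$ with $p^\infty_i<|r(\infty)|/(1+|r(\infty)|)$; if at least one such index exists, then the set $\{\gamma>0: r(\gamma L)\ge0\}$ is bounded above. (c) Assume in addition that $r'(0)=1$. If $L$ has a negative off-diagonal entry, then $r(\gamma L)$ has a negative entry for all sufficiently small $\gamma>0$; that is, the set $\{\gamma>0:r(\gamma L)\ge0\}$ is bounded away from zero.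
   Context: $\mathcal I$ is the identity matrix. Matrix inequalities $>0$, $\ge0$ are entrywise. $L$ is eventually exponentially positive if there is $\tau_0\ge0$ such that $e^{tL}>0$ for all $t\ge\tau_0$. The spectral abscissa is the maximal real part of the eigenvalues. The stationary density $\boldsymbol p^\infty$ is the right null vector of $L$ normalized by $\sum_i p^\infty_i=1$ (it is entrywise positive), and $\Pi=\lim_{t\to\infty}e^{tL}$ is the spectral projector onto $\ker L$ along $\operatorname{ran}L$, with entries $\Pi_{ij}=p^\infty_i$. A rational function $r$ is called A-acceptable if all its poles lie in the open right half-plane. $r(\infty)=\lim_{|z|\to\infty}r(z)$. For $r=P/Q$ (coprime polynomials) whose poles are not eigenvalues of $M$, $r(M)=P(M)Q(M)^{-1}$. *)

theory Defs
  imports "HOL-Analysis.Analysis" "HOL-Computational_Algebra.Computational_Algebra"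
begin

text \<open>The strict order of the class instance for vectors is not the entrywise strict order,
  so both entrywise relations are written out.\<close>

definition mat_pos :: "real^'n^'n \<Rightarrow> bool" where
  "mat_pos A \<longleftrightarrow> (\<forall>i j. A $ i $ j > 0)"

definition mat_nonneg :: "real^'n^'n \<Rightarrow> bool" where
  "mat_nonneg A \<longleftrightarrow> (\<forall>i j. A $ i $ j \<ge> 0)"

text \<open>The operations \<open>*\<close>, \<open>^\<close> and \<open>exp\<close> do not refer to the matrix product on the type of
  matrices, hence the following definitions in terms of \<open>**\<close>.\<close>

primrec mat_power :: "'a::semiring_1^'n^'n \<Rightarrow> nat \<Rightarrow> 'a^'n^'n" where
  "mat_power A 0 = mat 1"
| "mat_power A (Suc k) = A ** mat_power A k"

definition mat_exp :: "real^'n^'n \<Rightarrow> real^'n^'n" where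
  "mat_exp A = (\<Sum>k. (1 / fact k) *\<^sub>R mat_power A k)"

definition poly_mat :: "real poly \<Rightarrow> real^'n^'n \<Rightarrow> real^'n^'n" where
  "poly_mat p A = (\<Sum>k\<le>degree p. coeff p k *\<^sub>R mat_power A k)"

definition spec :: "real^'n^'n \<Rightarrow> complex set" where
  "spec A = {z. \<exists>v. v \<noteq> 0 \<and> map_matrix complex_of_real A *v v = z *s v}"

definition spectral_abscissa :: "real^'n^'n \<Rightarrow> real" where
  "spectral_abscissa A = Max (Re ` spec A)"

definition char_polynomial :: "complex^'n^'n \<Rightarrow> complex poly" where
  "char_polynomial A = det (mat [:0, 1:] - map_matrix (\<lambda>a. [:a:]) A)"

definition simple_eigenvalue :: "real^'n^'n \<Rightarrow> complex \<Rightarrow> bool" where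
  "simple_eigenvalue A z \<longleftrightarrow> order z (char_polynomial (map_matrix complex_of_real A)) = 1"

text \<open>Reducible: after a simultaneous permutation of rows and columns, block triangular with two
  nonempty diagonal blocks. The set \<open>S\<close> below consists of the indices of one of these blocks.\<close>

definition irreducible_mat :: "real^'n^'n \<Rightarrow> bool" where
  "irreducible_mat A \<longleftrightarrow>
     \<not> (\<exists>S. S \<noteq> {} \<and> S \<noteq> UNIV \<and> (\<forall>i\<in>- S. \<forall>j\<in>S. A $ i $ j = 0))"

definition zero_column_sums :: "real^'n^'n \<Rightarrow> bool" where
  "zero_column_sums A \<longleftrightarrow> (\<forall>j. (\<Sum>i\<in>UNIV. A $ i $ j) = 0)"

definition eventually_exp_positive :: "real^'n^'n \<Rightarrow> bool" where
  "eventually_exp_positive A \<longleftrightarrow> (\<exists>\<tau>0\<ge>0. \<forall>t\<ge>\<tau>0. mat_pos (mat_exp (t *\<^sub>R A)))"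

definition stationary_density :: "real^'n^'n \<Rightarrow> real^'n \<Rightarrow> bool" where
  "stationary_density A p \<longleftrightarrow> A *v p = 0 \<and> (\<Sum>i\<in>UNIV. p $ i) = 1"

text \<open>The projector onto the kernel of \<open>A\<close> along the range of \<open>A\<close>. For a simple eigenvalue \<open>0\<close> it
  exists and is the spectral projector of that eigenvalue.\<close>

definition spectral_projector :: "real^'n^'n \<Rightarrow> real^'n^'n \<Rightarrow> bool" where
  "spectral_projector A P \<longleftrightarrow>
     P ** P = P \<and> range ((*v) P) = {x. A *v x = 0} \<and> {x. P *v x = 0} = range ((*v) A)"

text \<open>A rational function is given by coprime numerator and denominator, so that its poles are the
  complex roots of the denominator.\<close>

definition rat_fun :: "real poly \<Rightarrow> real poly \<Rightarrow> complex \<Rightarrow> complex" where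
  "rat_fun P Q z = poly (map_poly complex_of_real P) z / poly (map_poly complex_of_real Q) z"

definition rat_poles :: "real poly \<Rightarrow> complex set" where
  "rat_poles Q = {z. poly (map_poly complex_of_real Q) z = 0}"

definition A_acceptable :: "real poly \<Rightarrow> bool" where
  "A_acceptable Q \<longleftrightarrow> (\<forall>z\<in>rat_poles Q. Re z > 0)"

definition rat_mat :: "real poly \<Rightarrow> real poly \<Rightarrow> real^'n^'n \<Rightarrow> real^'n^'n" where
  "rat_mat P Q A = poly_mat P A ** matrix_inv (poly_mat Q A)"

end

theory Submission
  imports Defs
begin

text \<open>For large \<open>t\<close> the matrix \<open>exp (t L)\<close> is positive and column-stochastic, and it fixes \<open>ker L\<close>.
  A fixed vector of such a matrix cannot change sign, so \<open>ker L\<close> is spanned by a positive vector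
  \<open>p\<close>, and all columns of the projector equal \<open>p\<close>. Since \<open>L\<close> is injective on \<open>ran L\<close>, only the
  coefficients of \<open>P\<close> and \<open>Q\<close> of degrees \<open>0\<close> and \<open>degree Q\<close> survive in the limit of \<open>r (\<gamma> L)\<close> as
  \<open>\<gamma> \<longrightarrow> \<infinity>\<close>, which gives the limit matrix and hence (a) and (b) entry by entry. Part (c) is the
  first-order expansion \<open>r (\<gamma> L) = 1 + \<gamma> L + o(\<gamma>)\<close> at \<open>\<gamma> = 0\<close>.\<close>

section \<open>Continuity of the matrix product, the determinant and the inverse\<close>

text \<open>Bilinear maps between finite-dimensional spaces are bounded, so this and the next
  interpretation supply distributivity, summation and limit rules for \<open>**\<close> and
  \<open>*v\<close>.\<close>

interpretation matrix_mul: bounded_bilinear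
  "(**) :: real^'n^'m \<Rightarrow> real^'k^'n \<Rightarrow> real^'k^'m"
  unfolding bilinear_conv_bounded_bilinear [symmetric] bilinear_def linear_iff
  by (auto simp: matrix_matrix_mult_def vec_eq_iff algebra_simps sum.distrib sum_distrib_left)

interpretation matrix_vec: bounded_bilinear
  "(*v) :: real^'n^'m \<Rightarrow> real^'n \<Rightarrow> real^'m"
  unfolding bilinear_conv_bounded_bilinear [symmetric] bilinear_def linear_iff
  by (auto simp: matrix_vector_mult_def vec_eq_iff algebra_simps sum.distrib sum_distrib_left)

lemma matrix_inv_works:
  fixes A :: "real^'n^'n"
  assumes "det A \<noteq> 0"
  shows "A ** matrix_inv A = mat 1" "matrix_inv A ** A = mat 1"
proof -
  have "\<exists>B. A ** B = mat 1 \<and> B ** A = mat 1"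
    using assms invertible_det_nz [of A] unfolding invertible_def by blast
  from someI_ex [OF this] show "A ** matrix_inv A = mat 1" "matrix_inv A ** A = mat 1"
    unfolding matrix_inv_def by auto
qed

text \<open>Cramer's rule for the \<open>j\<close>-th unit vector. It writes each entry of the
  inverse as a quotient of polynomials in the entries of \<open>A\<close>, which makes inversion
  continuous.\<close>

lemma matrix_inv_component:
  fixes A :: "real^'n^'n"
  assumes "det A \<noteq> 0"
  shows "matrix_inv A $ i $ j =
    det (\<chi> a b. if b = i then axis j 1 $ a else A $ a $ b) / det A"
proof -
  have "A *v (matrix_inv A *v axis j 1) = axis j 1"
    by (simp add: matrix_vector_mul_assoc matrix_inv_works assms)
  then have "matrix_inv A *v axis j 1 =
      (\<chi> k. det (\<chi> a b. if b = k then axis j 1 $ a else A $ a $ b) / det A)"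
    using cramer [OF assms] by blast
  moreover have "matrix_inv A $ i $ j = (matrix_inv A *v axis j 1) $ i"
    by (simp add: matrix_vector_mult_basis column_def)
  ultimately show ?thesis by simp
qed

lemma tendsto_matrix_iff:
  fixes f :: "'a \<Rightarrow> real^'n^'m"
  shows "(f \<longlongrightarrow> A) F \<longleftrightarrow> (\<forall>i j. ((\<lambda>x. f x $ i $ j) \<longlongrightarrow> A $ i $ j) F)"
proof (intro iffI allI)
  show "((\<lambda>x. f x $ i $ j) \<longlongrightarrow> A $ i $ j) F" if "(f \<longlongrightarrow> A) F" for i j
    by (rule tendsto_vec_nth [OF tendsto_vec_nth [OF that]])
  show "(f \<longlongrightarrow> A) F" if "\<forall>i j. ((\<lambda>x. f x $ i $ j) \<longlongrightarrow> A $ i $ j) F"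
    by (rule vec_tendstoI, rule vec_tendstoI) (use that in blast)
qed

lemma tendsto_det:
  fixes f :: "'a \<Rightarrow> real^'n^'n"
  assumes "(f \<longlongrightarrow> A) F"
  shows "((\<lambda>x. det (f x)) \<longlongrightarrow> det A) F"
  unfolding det_def using assms by (auto intro!: tendsto_intros simp: tendsto_matrix_iff)

lemma eventually_det_nz:
  fixes f :: "'a \<Rightarrow> real^'n^'n"
  assumes "(f \<longlongrightarrow> A) F" "det A \<noteq> 0"
  shows "\<forall>\<^sub>F x in F. det (f x) \<noteq> 0"
  using tendsto_imp_eventually_ne [OF tendsto_det [OF assms(1)] assms(2)] .

lemma tendsto_matrix_inv:
  fixes f :: "'a \<Rightarrow> real^'n^'n"
  assumes f: "(f \<longlongrightarrow> A) F" and A: "det A \<noteq> 0"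
  shows "((\<lambda>x. matrix_inv (f x)) \<longlongrightarrow> matrix_inv A) F"
  unfolding tendsto_matrix_iff
proof (intro allI)
  fix i j
  have "((\<lambda>x. det (\<chi> a b. if b = i then axis j 1 $ a else f x $ a $ b) / det (f x)) \<longlongrightarrow>
      det (\<chi> a b. if b = i then axis j 1 $ a else A $ a $ b) / det A) F"
    using f by (intro tendsto_divide tendsto_det f A) (auto simp: tendsto_matrix_iff)
  \<comment> \<open>The quotient of determinants is known to be the entry of
    \<open>matrix_inv (f x)\<close> once \<open>det (f x)\<close> is nonzero, which holds
    eventually.\<close>
  then show "((\<lambda>x. matrix_inv (f x) $ i $ j) \<longlongrightarrow> matrix_inv A $ i $ j) F"
    unfolding matrix_inv_component [OF A]
    by (rule Lim_transform_eventually)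
      (use eventually_det_nz [OF f A] in \<open>auto elim!: eventually_mono simp: matrix_inv_component\<close>)
qed

text \<open>Serves to find limits of quotients: the candidate \<open>M\<close> is verified by a
  product with \<open>S0\<close>, so that no inverse has to be computed.\<close>

lemma tendsto_matrix_right_divide:
  fixes R S T :: "'a \<Rightarrow> real^'n^'n"
  assumes S: "(S \<longlongrightarrow> S0) F" and "det S0 \<noteq> 0" and T: "(T \<longlongrightarrow> M ** S0) F"
    and eq: "\<forall>\<^sub>F x in F. R x ** S x = T x"
  shows "(R \<longlongrightarrow> M) F"
proof -
  have "((\<lambda>x. T x ** matrix_inv (S x)) \<longlongrightarrow> M ** S0 ** matrix_inv S0) F"
    by (intro matrix_mul.tendsto T tendsto_matrix_inv assms)
  moreover have "\<forall>\<^sub>F x in F. T x ** matrix_inv (S x) = R x"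
    using eventually_det_nz [OF assms(1,2)] eq
  proof eventually_elim
    case (elim x)
    then show ?case
      by (simp add: matrix_inv_works flip: matrix_mul_assoc elim(2))
  qed
  ultimately show ?thesis
    using assms(2) by (auto simp: matrix_inv_works simp flip: matrix_mul_assoc
        intro: Lim_transform_eventually)
qed

section \<open>Matrix powers and polynomials of matrices\<close>

lemma mat_power_scaleR: "mat_power (c *\<^sub>R A) k = c ^ k *\<^sub>R mat_power (A :: real^'n^'n) k"
  by (induction k) (simp_all add: matrix_mul.scaleR_left matrix_mul.scaleR_right mult.commute)

lemma mat_power_Suc_right: "mat_power A (Suc k) = mat_power (A :: real^'n^'n) k ** A"
  by (induction k) (simp_all add: matrix_mul_assoc)

text \<open>Coefficients past the degree vanish; a common summation bound lets polynomials of
  different degrees be combined term by term.\<close>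

lemma poly_mat_altdef:
  assumes "degree p \<le> d"
  shows "poly_mat p A = (\<Sum>k\<le>d. coeff p k *\<^sub>R mat_power A k)"
  unfolding poly_mat_def using assms
  by (intro sum.mono_neutral_left) (auto simp: coeff_eq_0)

lemma poly_mat_diff: "poly_mat (p - q) A = poly_mat p A - poly_mat q A"
proof -
  define d where "d = max (degree p) (degree q)"
  have "degree (p - q) \<le> d" "degree p \<le> d" "degree q \<le> d"
    unfolding d_def by (simp_all add: degree_diff_le_max)
  then show ?thesis
    by (simp add: poly_mat_altdef [where d = d] sum_subtractf scaleR_diff_left)
qed

lemma poly_mat_0 [simp]: "poly_mat 0 A = 0"
  by (simp add: poly_mat_def)

text \<open>Horner form, which opens \<open>poly_mat\<close> to induction over
  \<open>pCons\<close>.\<close>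

lemma poly_mat_pCons: "poly_mat (pCons a p) A = a *\<^sub>R mat 1 + A ** poly_mat p A"
proof -
  have "poly_mat (pCons a p) A =
      (\<Sum>k\<le>Suc (degree p). coeff (pCons a p) k *\<^sub>R mat_power A k)"
    by (rule poly_mat_altdef) (simp add: degree_pCons_le)
  then show ?thesis
    unfolding sum.atMost_Suc_shift
    by (simp add: poly_mat_def matrix_mul.sum_right matrix_mul.scaleR_right)
qed

lemma poly_mat_mult_kernel:
  fixes A B :: "real^'n^'n"
  assumes "A ** B = 0"
  shows "poly_mat p A ** B = coeff p 0 *\<^sub>R B"
  by (induction p)
    (simp_all add: poly_mat_pCons matrix_mul.add_left matrix_mul.scaleR_left
      matrix_mul.scaleR_right assms matrix_mul.zero_left flip: matrix_mul_assoc)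

lemma poly_mat_tendsto_0:
  fixes A :: "real^'n^'n"
  shows "((\<lambda>c. poly_mat p (c *\<^sub>R A)) \<longlongrightarrow> coeff p 0 *\<^sub>R mat 1) (at_right 0)"
proof (induction p)
  case 0
  then show ?case by simp
next
  case (pCons a p)
  have "((\<lambda>c. a *\<^sub>R mat 1 + (c *\<^sub>R A) ** poly_mat p (c *\<^sub>R A)) \<longlongrightarrow>
      a *\<^sub>R mat 1 + (0 *\<^sub>R A) ** (coeff p 0 *\<^sub>R mat 1)) (at_right 0)"
    by (intro tendsto_intros matrix_mul.tendsto pCons.IH)
  then show ?case
    by (simp add: poly_mat_pCons matrix_mul.zero_left)
qed

text \<open>After the division the term of index \<open>k\<close> carries the factor
  \<open>c ^ k / c ^ d\<close>, so only \<open>k = d\<close> survives. As \<open>d\<close> may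
  exceed the degree, numerator and denominator can be scaled by the same power.\<close>

lemma poly_mat_tendsto_at_top:
  fixes A :: "real^'n^'n"
  assumes "degree p \<le> d"
  shows "((\<lambda>c. (1 / c ^ d) *\<^sub>R poly_mat p (c *\<^sub>R A)) \<longlongrightarrow> coeff p d *\<^sub>R mat_power A d) at_top"
proof -
  have pow: "((\<lambda>c::real. c ^ k / c ^ d) \<longlongrightarrow> (if k = d then 1 else 0)) at_top" if "k \<le> d" for k
  proof (cases "k = d")
    case True
    have "\<forall>\<^sub>F c::real in at_top. 1 = c ^ k / c ^ d"
      using eventually_gt_at_top [of 0] by eventually_elim (simp add: True)
    then show ?thesis
      by (rule Lim_transform_eventually [rotated]) (simp add: True)
  next
    case False
    with that have "((\<lambda>c::real. inverse (c ^ (d - k))) \<longlongrightarrow> 0) at_top"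
      by (intro tendsto_inverse_0_at_top filterlim_pow_at_top filterlim_ident) auto
    moreover have "\<forall>\<^sub>F c::real in at_top. inverse (c ^ (d - k)) = c ^ k / c ^ d"
      using eventually_gt_at_top [of 0]
      by eventually_elim (use that in \<open>simp add: power_diff field_simps\<close>)
    ultimately show ?thesis
      using False by (auto intro: Lim_transform_eventually)
  qed
  have "((\<lambda>c. \<Sum>k\<le>d. (c ^ k / c ^ d) *\<^sub>R (coeff p k *\<^sub>R mat_power A k)) \<longlongrightarrow>
      (\<Sum>k\<le>d. (if k = d then 1 else 0) *\<^sub>R (coeff p k *\<^sub>R mat_power A k))) at_top"
    by (intro tendsto_sum tendsto_scaleR pow tendsto_const) auto
  moreover have "(\<Sum>k\<le>d. (if k = d then 1 else 0) *\<^sub>R (coeff p k *\<^sub>R mat_power A k)) =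
      (\<Sum>k\<le>d. if k = d then coeff p k *\<^sub>R mat_power A k else 0)"
    by (intro sum.cong) auto
  moreover have "\<dots> = coeff p d *\<^sub>R mat_power A d"
    by simp
  moreover have "(\<Sum>k\<le>d. (c ^ k / c ^ d) *\<^sub>R (coeff p k *\<^sub>R mat_power A k)) =
      (1 / c ^ d) *\<^sub>R poly_mat p (c *\<^sub>R A)" for c
    by (simp add: poly_mat_altdef [OF assms] scaleR_sum_right mat_power_scaleR mult_ac)
  ultimately show ?thesis by simp
qed

section \<open>Limits of the rational matrix function at infinity and at zero\<close>

lemma det_nz_if_kernel_trivial:
  fixes A :: "real^'n^'n"
  assumes "\<And>x. A *v x = 0 \<Longrightarrow> x = 0"
  shows "det A \<noteq> 0"
  using assms matrix_left_invertible_ker [of A] invertible_left_inverse [of A]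
    invertible_det_nz [of A] by metis

text \<open>With \<open>Z\<close> the projector, multiplying numerator and denominator on the right by the
  invertible matrix \<open>Z + c\<^sup>-\<^sup>d (1 - Z)\<close> makes both converge, the latter to an invertible limit.\<close>

lemma rat_mat_tendsto_at_top:
  fixes A Z :: "real^'n^'n"
  assumes AZ: "A ** Z = 0" and ZA: "Z ** A = 0" and ZZ: "Z ** Z = Z"
    and ker: "\<And>x. A *v x = 0 \<Longrightarrow> Z *v x = x"
    and deg: "degree P \<le> degree Q" and c0: "coeff P 0 = coeff Q 0" "coeff Q 0 \<noteq> 0"
    and lc: "coeff P (degree Q) = r * lead_coeff Q"
  shows "((\<lambda>c. rat_mat P Q (c *\<^sub>R A)) \<longlongrightarrow> Z + r *\<^sub>R (mat 1 - Z)) at_top"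
proof -
  define d where "d = degree Q"
  define D where "D c = Z + (1 / c ^ d) *\<^sub>R (mat 1 - Z)" for c :: real
  define S0 where "S0 = coeff Q 0 *\<^sub>R Z + (lead_coeff Q *\<^sub>R mat_power A d) ** (mat 1 - Z)"
  have "Q \<noteq> 0" using c0 by auto
  \<comment> \<open>For \<open>k = 0\<close> this is idempotence of \<open>Z\<close>; for
    \<open>k > 0\<close> it follows from \<open>ZA\<close>.\<close>
  have Zpow: "Z ** (mat_power A k ** (mat 1 - Z)) = 0" for k
    by (cases k) (simp_all add: matrix_mul.diff_right ZZ ZA matrix_mul_assoc
        matrix_mul.zero_left)
  have poly_D: "poly_mat p (c *\<^sub>R A) ** D c =
      coeff p 0 *\<^sub>R Z + ((1 / c ^ d) *\<^sub>R poly_mat p (c *\<^sub>R A)) ** (mat 1 - Z)" for p c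
  proof -
    have "poly_mat p (c *\<^sub>R A) ** Z = coeff p 0 *\<^sub>R Z"
      by (rule poly_mat_mult_kernel) (simp add: matrix_mul.scaleR_left AZ)
    then show ?thesis
      by (simp add: D_def matrix_mul.add_right matrix_mul.scaleR_right matrix_mul.scaleR_left)
  qed
  have lim: "((\<lambda>c. poly_mat p (c *\<^sub>R A) ** D c) \<longlongrightarrow>
      coeff p 0 *\<^sub>R Z + (coeff p d *\<^sub>R mat_power A d) ** (mat 1 - Z)) at_top"
    if "degree p \<le> d" for p
    unfolding poly_D by (intro tendsto_intros matrix_mul.tendsto poly_mat_tendsto_at_top that)
  have lim_Q: "((\<lambda>c. poly_mat Q (c *\<^sub>R A) ** D c) \<longlongrightarrow> S0) at_top"
    using lim [of Q] by (simp add: S0_def d_def)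
  have S0: "det S0 \<noteq> 0"
  proof (rule det_nz_if_kernel_trivial)
    fix x assume x: "S0 *v x = 0"
    \<comment> \<open>Multiplication by \<open>Z\<close> removes the summand with
      \<open>mat_power A d\<close>, so a null vector of \<open>S0\<close> is a null vector of
      \<open>Z\<close>.\<close>
    have "Z ** S0 = coeff Q 0 *\<^sub>R Z"
      by (simp add: S0_def matrix_mul.add_right matrix_mul.scaleR_right matrix_mul.scaleR_left
          ZZ Zpow)
    then have "coeff Q 0 *\<^sub>R (Z *v x) = Z *v (S0 *v x)"
      by (simp add: matrix_vector_mul_assoc matrix_vec.scaleR_left)
    with x c0 have Zx: "Z *v x = 0" by simp
    \<comment> \<open>By \<open>ker\<close>, \<open>A\<close> is injective on the null space of
      \<open>Z\<close>. The vectors \<open>mat_power A k *v x\<close> stay in that space, by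
      \<open>Zx\<close> for \<open>k = 0\<close> and by \<open>ZA\<close> otherwise.\<close>
    have pow: "mat_power A k *v x = 0 \<Longrightarrow> x = 0" for k
    proof (induction k)
      case (Suc k)
      have "Z *v (mat_power A k *v x) = 0"
        by (cases k) (simp_all add: Zx matrix_vector_mul_assoc matrix_mul_assoc ZA
            matrix_mul.zero_left matrix_vec.zero_left)
      moreover have "A *v (mat_power A k *v x) = 0"
        using Suc.prems by (simp add: matrix_vector_mul_assoc)
      ultimately have "mat_power A k *v x = 0"
        using ker by metis
      then show ?case by (rule Suc.IH)
    qed simp
    have "lead_coeff Q *\<^sub>R (mat_power A d *v x) = S0 *v x"
      using Zx by (simp add: S0_def matrix_vec.add_left matrix_vec.scaleR_left
          matrix_vec.diff_left matrix_mul.scaleR_left matrix_vec.diff_right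
          flip: matrix_vector_mul_assoc)
    with x \<open>Q \<noteq> 0\<close> show "x = 0" by (intro pow) simp
  qed
  \<comment> \<open>The claimed limit times \<open>S0\<close> is the limit of the numerator: the
    mixed terms vanish by \<open>ZZ\<close> and \<open>Zpow\<close>, and \<open>lc\<close> supplies
    the coefficient of \<open>P\<close>.\<close>
  have "(Z + r *\<^sub>R (mat 1 - Z)) ** S0 =
      coeff P 0 *\<^sub>R Z + (coeff P d *\<^sub>R mat_power A d) ** (mat 1 - Z)"
    by (simp add: S0_def c0 d_def lc matrix_mul.add_right matrix_mul.add_left
        matrix_mul.scaleR_right matrix_mul.scaleR_left matrix_mul.diff_left ZZ Zpow)
  then have lim_P: "((\<lambda>c. poly_mat P (c *\<^sub>R A) ** D c) \<longlongrightarrow>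
      (Z + r *\<^sub>R (mat 1 - Z)) ** S0) at_top"
    using lim [of P] deg by (simp add: d_def)
  have "\<forall>\<^sub>F c in at_top. rat_mat P Q (c *\<^sub>R A) ** (poly_mat Q (c *\<^sub>R A) ** D c) =
      poly_mat P (c *\<^sub>R A) ** D c"
    using eventually_det_nz [OF lim_Q S0]
  proof eventually_elim
    case (elim c)
    \<comment> \<open>A nonzero determinant of the product passes to its first factor, so the
      denominator is invertible for large \<open>c\<close>.\<close>
    then have "det (poly_mat Q (c *\<^sub>R A)) \<noteq> 0"
      by (auto simp: det_mul)
    then have "poly_mat P (c *\<^sub>R A) **
        (matrix_inv (poly_mat Q (c *\<^sub>R A)) ** poly_mat Q (c *\<^sub>R A)) = poly_mat P (c *\<^sub>R A)"
      by (simp add: matrix_inv_works)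
    then show ?case
      by (simp add: rat_mat_def matrix_mul_assoc)
  qed
  then show ?thesis
    by (rule tendsto_matrix_right_divide [OF lim_Q S0 lim_P])
qed

text \<open>\<open>P - Q\<close> vanishes at 0, hence equals \<open>x\<close> times a polynomial
  \<open>H\<close>, and the difference quotient is \<open>A\<close> times \<open>H (c A)\<close>
  over \<open>Q (c A)\<close>. By \<open>c1\<close>, \<open>H\<close> and \<open>Q\<close> agree at
  0, so the last two factors cancel in the limit.\<close>

lemma rat_mat_tendsto_at_right_0:
  fixes A :: "real^'n^'n"
  assumes c0: "coeff P 0 = coeff Q 0" "coeff Q 0 \<noteq> 0"
    and c1: "coeff P 1 - coeff Q 1 = coeff Q 0"
  shows "((\<lambda>c. (1 / c) *\<^sub>R (rat_mat P Q (c *\<^sub>R A) - mat 1)) \<longlongrightarrow> A) (at_right 0)"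
proof -
  obtain H where H: "P - Q = pCons 0 H"
    using c0 by (cases "P - Q") (metis coeff_diff coeff_pCons_0 diff_self)
  have "coeff H 0 = coeff Q 0"
    using c1 arg_cong [OF H, of "\<lambda>p. coeff p 1"] by simp
  have lim_H: "((\<lambda>c. A ** poly_mat H (c *\<^sub>R A)) \<longlongrightarrow> A ** (coeff Q 0 *\<^sub>R mat 1)) (at_right 0)"
    unfolding \<open>coeff H 0 = coeff Q 0\<close> [symmetric]
    by (intro matrix_mul.tendsto poly_mat_tendsto_0 tendsto_const)
  have lim_Q: "((\<lambda>c. poly_mat Q (c *\<^sub>R A)) \<longlongrightarrow> coeff Q 0 *\<^sub>R mat 1) (at_right 0)"
    by (rule poly_mat_tendsto_0)
  have det: "det (coeff Q 0 *\<^sub>R mat 1 :: real^'n^'n) \<noteq> 0"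
    by (rule det_nz_if_kernel_trivial) (simp add: matrix_vec.scaleR_left c0)
  have "\<forall>\<^sub>F c in at_right 0. ((1 / c) *\<^sub>R (rat_mat P Q (c *\<^sub>R A) - mat 1)) **
      poly_mat Q (c *\<^sub>R A) = A ** poly_mat H (c *\<^sub>R A)"
    using eventually_det_nz [OF lim_Q det] eventually_at_right_less [of 0]
  proof eventually_elim
    case (elim c)
    have "(rat_mat P Q (c *\<^sub>R A) - mat 1) ** poly_mat Q (c *\<^sub>R A) = poly_mat (P - Q) (c *\<^sub>R A)"
      using elim by (simp add: rat_mat_def matrix_mul.diff_left poly_mat_diff matrix_inv_works
          flip: matrix_mul_assoc)
    also have "\<dots> = c *\<^sub>R (A ** poly_mat H (c *\<^sub>R A))"
      by (simp add: H poly_mat_pCons matrix_mul.scaleR_left)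
    finally show ?case
      using elim by (simp add: matrix_mul.scaleR_left)
  qed
  then show ?thesis
    by (rule tendsto_matrix_right_divide [OF lim_Q det lim_H])
qed

section \<open>Convergence and invariants of the matrix exponential\<close>

lemma mat_power_component_bound:
  fixes A :: "real^'n^'n"
  assumes "\<And>i j. \<bar>A $ i $ j\<bar> \<le> b" "1 \<le> b"
  shows "\<bar>mat_power A k $ i $ j\<bar> \<le> (real CARD('n) * b) ^ k"
proof (induction k arbitrary: i j)
  case 0
  then show ?case by (simp add: mat_def)
next
  case (Suc k)
  have "\<bar>mat_power A (Suc k) $ i $ j\<bar> \<le> (\<Sum>l\<in>UNIV. \<bar>A $ i $ l * mat_power A k $ l $ j\<bar>)"
    by (simp add: matrix_matrix_mult_def sum_abs)
  also have "\<dots> \<le> (\<Sum>l\<in>(UNIV :: 'n set). b * (real CARD('n) * b) ^ k)"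
    using assms Suc.IH by (intro sum_mono) (simp add: abs_mult mult_mono)
  finally show ?case by (simp add: mult_ac)
qed

text \<open>Comparison with the scalar exponential series; the factor \<open>real CARD('n)^2\<close>
  arises from bounding the norm by the sum of all absolute entries.\<close>

lemma summable_mat_exp:
  fixes A :: "real^'n^'n"
  shows "summable (\<lambda>k. (1 / fact k) *\<^sub>R mat_power A k)"
proof -
  define b where "b = 1 + (\<Sum>i\<in>UNIV. \<Sum>j\<in>UNIV. \<bar>A $ i $ j\<bar>)"
  have b: "\<bar>A $ i $ j\<bar> \<le> b" for i j
  proof -
    have "\<bar>A $ i $ j\<bar> \<le> (\<Sum>j\<in>UNIV. \<bar>A $ i $ j\<bar>)"
      by (rule member_le_sum) auto
    also have "\<dots> \<le> (\<Sum>i\<in>UNIV. \<Sum>j\<in>UNIV. \<bar>A $ i $ j\<bar>)"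
      by (rule member_le_sum [of _ _ "\<lambda>i. \<Sum>j\<in>UNIV. \<bar>A $ i $ j\<bar>"]) (auto intro: sum_nonneg)
    finally show ?thesis by (simp add: b_def)
  qed
  have "1 \<le> b" by (simp add: b_def sum_nonneg)
  let ?c = "real CARD('n) * b"
  have "norm ((1 / fact k) *\<^sub>R mat_power A k) \<le> real CARD('n)^2 * (inverse (fact k) * ?c ^ k)" for k
  proof -
    have "norm (mat_power A k) \<le> (\<Sum>i\<in>UNIV. norm (mat_power A k $ i))"
      by (simp add: norm_vec_def L2_set_le_sum)
    also have "\<dots> \<le> (\<Sum>i\<in>(UNIV :: 'n set). \<Sum>j\<in>UNIV. \<bar>mat_power A k $ i $ j\<bar>)"
      by (intro sum_mono norm_le_l1_cart)
    also have "\<dots> \<le> (\<Sum>i\<in>(UNIV :: 'n set). \<Sum>j\<in>(UNIV :: 'n set). ?c ^ k)"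
      by (intro sum_mono mat_power_component_bound b \<open>1 \<le> b\<close>)
    finally show ?thesis
      by (simp add: field_simps power2_eq_square)
  qed
  moreover have "summable (\<lambda>k. real CARD('n)^2 * (inverse (fact k) * ?c ^ k))"
    by (intro summable_mult summable_exp)
  ultimately show ?thesis
    by (rule summable_comparison_test' [rotated])
qed

text \<open>A linear map in finite dimension is continuous and passes through the series, of which
  only the term of index 0 remains. It is applied to the action on a fixed vector and to column
  sums.\<close>

lemma linear_mat_exp:
  fixes f :: "real^'n^'n \<Rightarrow> 'b::real_normed_vector"
  assumes "linear f" and powers: "\<And>k. f (mat_power A (Suc k)) = 0"
  shows "f (mat_exp A) = f (mat 1)"
proof -
  interpret bounded_linear f
    using assms(1) by (simp add: linear_conv_bounded_linear)
  have "f (mat_exp A) = (\<Sum>k. f ((1 / fact k) *\<^sub>R mat_power A k))"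
    unfolding mat_exp_def by (rule suminf [OF summable_mat_exp])
  also have "\<dots> = (\<Sum>k\<in>{0}. f ((1 / fact k) *\<^sub>R mat_power A k))"
  proof (rule suminf_finite)
    fix k :: nat assume "k \<notin> {0}"
    then obtain l where "k = Suc l" by (cases k) auto
    then show "f ((1 / fact k) *\<^sub>R mat_power A k) = 0" by (simp add: scaleR powers del: mat_power.simps)
  qed simp
  finally show ?thesis by simp
qed

lemma mat_exp_fixes_kernel:
  fixes A :: "real^'n^'n"
  assumes "A *v x = 0"
  shows "mat_exp A *v x = x"
proof -
  have "mat_power A (Suc k) *v x = 0" for k
    using assms by (simp add: mat_power_Suc_right del: mat_power.simps flip: matrix_vector_mul_assoc)
  then have "mat_exp A *v x = mat 1 *v x"
    by (intro linear_mat_exp [where f = "\<lambda>M. M *v x"] matrix_vec.bounded_linear_left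
        bounded_linear.linear)
  then show ?thesis by simp
qed

section \<open>Positive column-stochastic matrices and their fixed vectors\<close>

lemma column_sums_mult:
  fixes A B :: "real^'n^'n"
  shows "(\<Sum>i\<in>UNIV. (A ** B) $ i $ j) = (\<Sum>k\<in>UNIV. (\<Sum>i\<in>UNIV. A $ i $ k) * B $ k $ j)"
  unfolding matrix_matrix_mult_def by (simp add: sum_distrib_right) (rule sum.swap)

lemma mat_exp_column_sums:
  fixes A :: "real^'n^'n"
  assumes "zero_column_sums A"
  shows "(\<Sum>i\<in>UNIV. mat_exp A $ i $ j) = 1"
proof -
  have "(\<Sum>i\<in>UNIV. mat_power A (Suc k) $ i $ j) = 0" for k
    using assms by (simp add: column_sums_mult zero_column_sums_def)
  then have "(\<Sum>i\<in>UNIV. mat_exp A $ i $ j) = (\<Sum>i\<in>UNIV. (mat 1 :: real^'n^'n) $ i $ j)"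
    by (intro linear_mat_exp [where f = "\<lambda>M :: real^'n^'n. \<Sum>i\<in>UNIV. M $ i $ j"])
      (simp_all add: linear_iff sum.distrib sum_distrib_left)
  also have "\<dots> = 1" by (simp add: mat_def)
  finally show ?thesis .
qed

text \<open>The negative part \<open>y\<close> of \<open>x\<close> satisfies \<open>y \<le> E y\<close>, with equality since both sides have the same
  sum. Hence \<open>y\<close> is zero or entrywise positive.\<close>

lemma positive_stochastic_fixed_nonneg:
  fixes E :: "real^'n^'n" and x :: "real^'n"
  assumes E: "mat_pos E" and sums: "\<And>j. (\<Sum>i\<in>UNIV. E $ i $ j) = 1"
    and fixed: "E *v x = x" and x: "(\<Sum>i\<in>UNIV. x $ i) \<ge> 0"
  shows "x $ i \<ge> 0"
proof (rule ccontr)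
  assume "\<not> x $ i \<ge> 0"
  define y where "y i = max (- x $ i) 0" for i
  have Epos: "E $ i $ j > 0" for i j using E by (simp add: mat_pos_def)
  have Ex: "x $ i = (\<Sum>j\<in>UNIV. E $ i $ j * x $ j)" for i
    using arg_cong [OF fixed, of "\<lambda>v. v $ i"] by (simp add: matrix_vector_mult_def)
  have le: "y i \<le> (\<Sum>j\<in>UNIV. E $ i $ j * y j)" for i
  proof -
    have "- x $ i = (\<Sum>j\<in>UNIV. E $ i $ j * (- x $ j))"
      by (subst Ex) (simp add: sum_negf)
    also have "\<dots> \<le> (\<Sum>j\<in>UNIV. E $ i $ j * y j)"
      using Epos by (intro sum_mono mult_left_mono) (auto simp: y_def less_imp_le)
    moreover have "0 \<le> (\<Sum>j\<in>UNIV. E $ i $ j * y j)"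
      using Epos by (intro sum_nonneg mult_nonneg_nonneg) (auto simp: y_def less_imp_le)
    ultimately show ?thesis by (simp add: y_def)
  qed
  have "(\<Sum>i\<in>UNIV. \<Sum>j\<in>UNIV. E $ i $ j * y j) = (\<Sum>j\<in>UNIV. y j)"
    by (subst sum.swap) (simp add: sums flip: sum_distrib_right)
  then have "(\<Sum>i\<in>UNIV. (\<Sum>j\<in>UNIV. E $ i $ j * y j) - y i) = 0"
    by (simp add: sum_subtractf)
  then have eq: "y k = (\<Sum>j\<in>UNIV. E $ k $ j * y j)" for k
    using le by (subst (asm) sum_nonneg_eq_0_iff) auto
  \<comment> \<open>One negative entry of \<open>x\<close> makes \<open>y i\<close> positive, and
    the positive row \<open>k\<close> of \<open>E\<close> carries this over to
    \<open>y k\<close>.\<close>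
  have "x $ k < 0" for k
  proof -
    have "0 < (\<Sum>j\<in>UNIV. E $ k $ j * y j)"
      using Epos \<open>\<not> x $ i \<ge> 0\<close>
      by (intro sum_pos2 [of _ i]) (auto simp: y_def less_imp_le mult_pos_neg)
    then show ?thesis using eq [of k] by (simp add: y_def)
  qed
  then have "(\<Sum>i\<in>UNIV. x $ i) < (\<Sum>i\<in>(UNIV :: 'n set). 0)"
    by (intro sum_strict_mono) auto
  with x show False by simp
qed

text \<open>\<open>E\<close> is \<open>mat_exp (t *\<^sub>R L)\<close> for a single suitable
  \<open>t\<close>. The facts about \<open>p\<close> and the kernel of \<open>L\<close> below use
  the exponential through this matrix alone.\<close>

lemma obtain_positive_stochastic:
  fixes L :: "real^'n^'n"
  assumes "zero_column_sums L" "eventually_exp_positive L"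
  obtains E :: "real^'n^'n" where "mat_pos E" "\<And>j. (\<Sum>i\<in>UNIV. E $ i $ j) = 1"
    "\<And>x. L *v x = 0 \<Longrightarrow> E *v x = x"
proof -
  obtain t where "mat_pos (mat_exp (t *\<^sub>R L))"
    using assms(2) unfolding eventually_exp_positive_def by blast
  moreover have "zero_column_sums (t *\<^sub>R L)"
    using assms(1) by (simp add: zero_column_sums_def flip: sum_distrib_left)
  ultimately show thesis
    by (intro that [of "mat_exp (t *\<^sub>R L)"])
      (auto intro: mat_exp_column_sums mat_exp_fixes_kernel simp: matrix_vec.scaleR_left)
qed

text \<open>A fixed vector of \<open>E\<close> with sum 1 is nonnegative and nonzero, and one
  application of the positive matrix \<open>E\<close> makes it positive.\<close>

lemma stationary_density_pos:
  fixes L :: "real^'n^'n" and p :: "real^'n"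
  assumes "zero_column_sums L" "eventually_exp_positive L" "stationary_density L p"
  shows "p $ i > 0"
proof -
  obtain E :: "real^'n^'n" where E: "mat_pos E" "\<And>j. (\<Sum>i\<in>UNIV. E $ i $ j) = 1"
    "\<And>x. L *v x = 0 \<Longrightarrow> E *v x = x"
    using obtain_positive_stochastic [OF assms(1,2)] by blast
  have p: "E *v p = p" "(\<Sum>i\<in>UNIV. p $ i) = 1"
    using assms(3) E(3) by (auto simp: stationary_density_def)
  have nonneg: "p $ j \<ge> 0" for j
    using positive_stochastic_fixed_nonneg [OF E(1,2) p(1)] p(2) by simp
  have "\<exists>j. p $ j \<noteq> 0"
    using p(2) by (metis sum.neutral zero_neq_one)
  then obtain j where "p $ j > 0" using nonneg by (metis less_eq_real_def)
  then have "0 < (\<Sum>j\<in>UNIV. E $ i $ j * p $ j)"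
    using E(1) nonneg by (intro sum_pos2 [of _ j]) (auto simp: mat_pos_def less_imp_le)
  also have "\<dots> = p $ i"
    using arg_cong [OF p(1), of "\<lambda>v. v $ i"] by (simp add: matrix_vector_mult_def)
  finally show ?thesis .
qed

text \<open>The difference of both sides is a fixed vector of \<open>E\<close> with sum 0; it is
  nonnegative, hence zero.\<close>

lemma kernel_eq_sum_scaleR_density:
  fixes L :: "real^'n^'n" and p x :: "real^'n"
  assumes "zero_column_sums L" "eventually_exp_positive L" "stationary_density L p"
    and "L *v x = 0"
  shows "x = (\<Sum>i\<in>UNIV. x $ i) *\<^sub>R p"
proof -
  obtain E :: "real^'n^'n" where E: "mat_pos E" "\<And>j. (\<Sum>i\<in>UNIV. E $ i $ j) = 1"
    "\<And>x. L *v x = 0 \<Longrightarrow> E *v x = x"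
    using obtain_positive_stochastic [OF assms(1,2)] by blast
  define y where "y = x - (\<Sum>i\<in>UNIV. x $ i) *\<^sub>R p"
  have "L *v y = 0"
    using assms(3,4) by (simp add: y_def stationary_density_def matrix_vec.diff_right
        matrix_vec.scaleR_right)
  then have Ey: "E *v y = y" by (rule E(3))
  have y0: "(\<Sum>i\<in>UNIV. y $ i) = 0"
    using assms(3) by (simp add: y_def stationary_density_def sum_subtractf flip: sum_distrib_left)
  have "y $ i \<ge> 0" for i
    using positive_stochastic_fixed_nonneg [OF E(1,2) Ey] y0 by simp
  then have "y = 0"
    using y0 by (simp add: sum_nonneg_eq_0_iff vec_eq_iff)
  then show ?thesis by (simp add: y_def)
qed

section \<open>Entries of the spectral projector\<close>

lemma spectral_projector_mult:
  fixes A Z :: "real^'n^'n"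
  assumes "spectral_projector A Z"
  shows "Z ** Z = Z" "A ** Z = 0" "Z ** A = 0" "A *v x = 0 \<Longrightarrow> Z *v x = x"
proof -
  have ran: "range ((*v) Z) = {x. A *v x = 0}" and ker: "{x. Z *v x = 0} = range ((*v) A)"
    and ZZ: "Z ** Z = Z"
    using assms unfolding spectral_projector_def by simp_all
  show "Z ** Z = Z" by (fact ZZ)
  show "A ** Z = 0"
  proof -
    have "A *v (Z *v x) = 0" for x using rangeI [of "(*v) Z" x] unfolding ran by simp
    then show ?thesis
      unfolding matrix_eq matrix_vector_mul_assoc matrix_vec.zero_left by blast
  qed
  show "Z ** A = 0"
  proof -
    have "Z *v (A *v x) = 0" for x using rangeI [of "(*v) A" x] unfolding ker [symmetric] by simp
    then show ?thesis
      unfolding matrix_eq matrix_vector_mul_assoc matrix_vec.zero_left by blast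
  qed
  show "Z *v x = x" if "A *v x = 0"
  proof -
    have "x \<in> range ((*v) Z)" unfolding ran using that by simp
    then obtain y where "x = Z *v y" by (rule rangeE)
    then show ?thesis by (simp add: matrix_vector_mul_assoc ZZ)
  qed
qed

text \<open>A unit vector \<open>x\<close> splits as \<open>Z *v x + L *v y\<close>. Zero column
  sums make the entries of \<open>L *v y\<close> sum to 0, so \<open>Z *v x\<close> is a kernel
  vector of sum 1, which is \<open>p\<close>.\<close>

lemma spectral_projector_component:
  fixes L Z :: "real^'n^'n" and p :: "real^'n"
  assumes "zero_column_sums L" "eventually_exp_positive L" "stationary_density L p"
    and Z: "spectral_projector L Z"
  shows "Z $ i $ j = p $ i"
proof -
  have sum0: "(\<Sum>i\<in>UNIV. (L *v y) $ i) = 0" for y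
  proof -
    have "(\<Sum>i\<in>UNIV. (L *v y) $ i) = (\<Sum>k\<in>UNIV. (\<Sum>i\<in>UNIV. L $ i $ k) * y $ k)"
      unfolding matrix_vector_mult_def by (simp add: sum_distrib_right) (rule sum.swap)
    then show ?thesis using assms(1) by (simp add: zero_column_sums_def)
  qed
  define x :: "real^'n" where "x = axis j 1"
  have "Z *v (x - Z *v x) = 0"
    using spectral_projector_mult(1) [OF Z]
    by (simp add: matrix_vec.diff_right matrix_vector_mul_assoc)
  then obtain y where y: "x - Z *v x = L *v y"
    using Z unfolding spectral_projector_def by blast
  have "L *v (Z *v x) = 0"
    using spectral_projector_mult(2) [OF Z]
    by (simp add: matrix_vector_mul_assoc matrix_vec.zero_left)
  then have "Z *v x = (\<Sum>i\<in>UNIV. (Z *v x) $ i) *\<^sub>R p"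
    by (rule kernel_eq_sum_scaleR_density [OF assms(1-3)])
  moreover have "(\<Sum>i\<in>UNIV. (Z *v x) $ i) = (\<Sum>i\<in>UNIV. x $ i)"
    using sum0 [of y] unfolding y [symmetric] by (simp add: sum_subtractf)
  moreover have "(\<Sum>i\<in>UNIV. x $ i) = 1"
    by (simp add: x_def axis_def)
  ultimately have "Z *v x = p" by simp
  then show ?thesis
    by (auto simp: x_def matrix_vector_mult_basis column_def vec_eq_iff)
qed

section \<open>Coefficients of the scalar rational function\<close>

text \<open>Multiplying by \<open>Q(z) / z ^ degree Q\<close> turns the hypothesis into a limit of
  \<open>P(z) / z ^ degree Q\<close>, to be compared with that of
  \<open>P(z) / z ^ degree P\<close>.\<close>

lemma rat_fun_limit_coeffs:
  assumes Q: "Q \<noteq> 0"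
    and lim: "(rat_fun P Q \<longlongrightarrow> complex_of_real r) at_infinity"
  shows "degree P \<le> degree Q" "coeff P (degree Q) = r * lead_coeff Q"
proof -
  define P' where "P' = map_poly complex_of_real P"
  define Q' where "Q' = map_poly complex_of_real Q"
  have deg: "degree P' = degree P" "degree Q' = degree Q"
    by (simp_all add: P'_def Q'_def degree_map_poly)
  have lc: "coeff P' (degree P) = lead_coeff P" "coeff Q' (degree Q) = lead_coeff Q"
    by (simp_all add: P'_def Q'_def coeff_map_poly)
  have "Q' \<noteq> 0" using Q lc(2) by auto
  have nz: "\<forall>\<^sub>F z in at_infinity. poly Q' z \<noteq> 0"
  proof -
    have "finite {z. poly Q' z = 0}" by (rule poly_roots_finite [OF \<open>Q' \<noteq> 0\<close>])
    then obtain b where "\<forall>z\<in>{z. poly Q' z = 0}. norm z \<le> b"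
      using finite_imp_bounded bounded_iff by metis
    then show ?thesis
      by (intro eventually_at_infinityI [of "b + 1"]) fastforce
  qed
  have "((\<lambda>z. rat_fun P Q z * (poly Q' z / z ^ degree Q')) \<longlongrightarrow> r * lead_coeff Q') at_infinity"
    by (intro tendsto_mult lim poly_divide_tendsto_aux)
  then have main: "((\<lambda>z. poly P' z / z ^ degree Q) \<longlongrightarrow> r * lead_coeff Q) at_infinity"
    unfolding deg lc of_real_mult
    by (rule Lim_transform_eventually)
      (use nz in \<open>auto elim!: eventually_mono simp: rat_fun_def P'_def Q'_def\<close>)
  have lim_P: "((\<lambda>z. poly P' z / z ^ degree P) \<longlongrightarrow> lead_coeff P) at_infinity"
    using poly_divide_tendsto_aux [of P'] by (simp add: deg lc del: of_real_eq_iff)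
  show deg_le: "degree P \<le> degree Q"
  proof (rule ccontr)
    assume "\<not> degree P \<le> degree Q"
    define k where "k = degree P - degree Q"
    have k: "0 < k" "degree P = degree Q + k"
      using \<open>\<not> degree P \<le> degree Q\<close> by (simp_all add: k_def)
    \<comment> \<open>The surplus power would force the leading coefficient of \<open>P\<close> to
      be 0 although \<open>P\<close> has positive degree.\<close>
    have "((\<lambda>z::complex. inverse (z ^ k)) \<longlongrightarrow> 0) at_infinity"
      using k(1) by (intro tendsto_inverse_0 [THEN filterlim_compose] filterlim_power_at_infinity) simp
    from tendsto_mult [OF main this]
    have "((\<lambda>z. poly P' z / z ^ degree P) \<longlongrightarrow> 0) at_infinity"
      by (simp add: k(2) power_add field_simps)
    then have "complex_of_real (lead_coeff P) = 0"
      by (rule tendsto_unique [OF trivial_limit_at_infinity lim_P])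
    then have "P = 0" by simp
    with k show False by simp
  qed
  show "coeff P (degree Q) = r * lead_coeff Q"
  proof (cases "degree P = degree Q")
    case True
    have "complex_of_real (lead_coeff P) = r * lead_coeff Q"
      by (rule tendsto_unique [OF trivial_limit_at_infinity lim_P]) (use main True in simp)
    then show ?thesis
      unfolding True by (metis of_real_eq_iff of_real_mult)
  next
    \<comment> \<open>Here both sides are 0: the coefficient lies past the degree of
      \<open>P\<close>, and the limit forces \<open>r * lead_coeff Q = 0\<close>.\<close>
    case False
    define k where "k = degree Q - degree P"
    have k: "0 < k" "degree Q = degree P + k"
      using False deg_le by (simp_all add: k_def)
    have "((\<lambda>z::complex. inverse (z ^ k)) \<longlongrightarrow> 0) at_infinity"
      using k(1) by (intro tendsto_inverse_0 [THEN filterlim_compose] filterlim_power_at_infinity) simp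
    from tendsto_mult [OF lim_P this]
    have "((\<lambda>z. poly P' z / z ^ degree Q) \<longlongrightarrow> 0) at_infinity"
      by (simp add: k(2) power_add field_simps)
    with main have "complex_of_real (r * lead_coeff Q) = 0"
      by (rule tendsto_unique [OF trivial_limit_at_infinity])
    then show ?thesis
      using k by (simp add: coeff_eq_0 del: of_real_mult)
  qed
qed

text \<open>Since division by 0 yields 0, the value 1 excludes a zero denominator.\<close>

lemma rat_fun_at_0:
  assumes "rat_fun P Q 0 = 1"
  shows "coeff P 0 = coeff Q 0" "coeff Q 0 \<noteq> 0"
proof -
  have "rat_fun P Q 0 = complex_of_real (coeff P 0 / coeff Q 0)"
    by (simp add: rat_fun_def poly_0_coeff_0 coeff_map_poly)
  with assms have "coeff P 0 / coeff Q 0 = 1"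
    by (simp del: of_real_divide)
  then show "coeff P 0 = coeff Q 0" "coeff Q 0 \<noteq> 0"
    by (auto simp: divide_eq_1_iff)
qed

text \<open>The quotient rule at 0, where \<open>P\<close> and \<open>Q\<close> have the same
  nonzero value, which cancels.\<close>

lemma deriv_rat_fun_at_0:
  assumes "rat_fun P Q 0 = 1" "deriv (rat_fun P Q) 0 = 1"
  shows "coeff P 1 - coeff Q 1 = coeff Q 0"
proof -
  note c0 = rat_fun_at_0 [OF assms(1)]
  let ?P = "map_poly complex_of_real P" and ?Q = "map_poly complex_of_real Q"
  have coeffs: "poly ?P 0 = coeff P 0" "poly ?Q 0 = coeff Q 0"
    "poly (pderiv ?P) 0 = coeff P 1" "poly (pderiv ?Q) 0 = coeff Q 1"
    by (simp_all add: poly_0_coeff_0 coeff_map_poly coeff_pderiv)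
  have "(rat_fun P Q has_field_derivative
      (poly (pderiv ?P) 0 * poly ?Q 0 - poly ?P 0 * poly (pderiv ?Q) 0) /
      (poly ?Q 0 * poly ?Q 0)) (at 0)"
    unfolding rat_fun_def [abs_def] using c0 by (intro DERIV_divide poly_DERIV) (simp add: coeffs)
  from DERIV_imp_deriv [OF this] assms(2)
  have "complex_of_real ((coeff P 1 * coeff Q 0 - coeff P 0 * coeff Q 1) /
      (coeff Q 0 * coeff Q 0)) = 1"
    unfolding coeffs by simp
  then have "(coeff P 1 * coeff Q 0 - coeff P 0 * coeff Q 1) / (coeff Q 0 * coeff Q 0) = 1"
    by (simp only: of_real_eq_1_iff)
  then have "(coeff P 1 - coeff Q 1) * coeff Q 0 = coeff Q 0 * coeff Q 0"
    using c0 by (simp add: field_simps)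
  with c0 show ?thesis by simp
qed

section \<open>Signs of the entries near a limit\<close>

lemma eventually_component_neg:
  fixes f :: "'a \<Rightarrow> real^'n^'m" and A :: "real^'n^'m"
  assumes "(f \<longlongrightarrow> A) F" "A $ i $ j < 0"
  shows "\<forall>\<^sub>F x in F. f x $ i $ j < 0"
  using assms order_tendstoD(2) unfolding tendsto_matrix_iff by blast

lemma eventually_mat_pos:
  fixes f :: "'a \<Rightarrow> real^'n^'n"
  assumes "(f \<longlongrightarrow> A) F" "mat_pos A"
  shows "\<forall>\<^sub>F x in F. mat_pos (f x)"
  unfolding mat_pos_def
proof (intro eventually_all_finite)
  fix i j
  show "\<forall>\<^sub>F x in F. 0 < f x $ i $ j"
    using assms order_tendstoD(1) unfolding tendsto_matrix_iff mat_pos_def by blast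
qed

theorem corollary1:
  fixes L Proj Minf :: "real^'n^'n" and p :: "real^'n"
    and P Q :: "real poly" and rinf :: real
  assumes "irreducible_mat L"
    and "zero_column_sums L"
    and "spectral_abscissa L = 0"
    and "simple_eigenvalue L 0"
    and "eventually_exp_positive L"
    and "stationary_density L p"
    and "spectral_projector L Proj"
    and "Q \<noteq> 0" and "coprime P Q"
    and "A_acceptable Q"
    and "rat_fun P Q 0 = 1"
    and "(rat_fun P Q \<longlongrightarrow> complex_of_real rinf) at_infinity"
    and "\<forall>\<gamma>>0. rat_poles Q \<inter> spec (\<gamma> *\<^sub>R L) = {}"
    and "Minf = Proj + rinf *\<^sub>R (mat 1 - Proj)"
  shows "((\<lambda>\<gamma>. rat_mat P Q (\<gamma> *\<^sub>R L)) \<longlongrightarrow> Minf) at_top \<and>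
    (0 \<le> rinf \<and> rinf < 1 \<longrightarrow>
      mat_pos Minf \<and> (\<exists>\<gamma>\<^sub>r>0. \<forall>\<gamma>\<ge>\<gamma>\<^sub>r. mat_pos (rat_mat P Q (\<gamma> *\<^sub>R L)))) \<and>
    (rinf < 0 \<longrightarrow>
      (\<forall>i. p $ i < \<bar>rinf\<bar> / (1 + \<bar>rinf\<bar>) \<longrightarrow> Minf $ i $ i < 0) \<and>
      ((\<exists>i. p $ i < \<bar>rinf\<bar> / (1 + \<bar>rinf\<bar>)) \<longrightarrow>
        bdd_above {\<gamma>. \<gamma> > 0 \<and> mat_nonneg (rat_mat P Q (\<gamma> *\<^sub>R L))})) \<and>
    (deriv (rat_fun P Q) 0 = 1 \<and> (\<exists>i j. i \<noteq> j \<and> L $ i $ j < 0) \<longrightarrow>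
      (\<forall>\<^sub>F \<gamma> in at_right 0. \<exists>i j. rat_mat P Q (\<gamma> *\<^sub>R L) $ i $ j < 0) \<and>
      (\<exists>\<delta>>0. \<forall>\<gamma>\<in>{\<gamma>. \<gamma> > 0 \<and> mat_nonneg (rat_mat P Q (\<gamma> *\<^sub>R L))}. \<delta> \<le> \<gamma>))"
proof (intro conjI impI)
  let ?R = "\<lambda>\<gamma>. rat_mat P Q (\<gamma> *\<^sub>R L)"
  note density = assms(2,5,6)
  note coeffs = rat_fun_at_0 [OF assms(11)]
  show lim: "(?R \<longlongrightarrow> Minf) at_top"
    unfolding assms(14)
    by (intro rat_mat_tendsto_at_top spectral_projector_mult [OF assms(7)]
        rat_fun_limit_coeffs [OF assms(8,12)] coeffs)
  \<comment> \<open>For \<open>rinf < 0\<close> the diagonal entry is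
    \<open>(1 + \<bar>rinf\<bar>) * p $ i - \<bar>rinf\<bar>\<close>, which explains the threshold
    on \<open>p $ i\<close>.\<close>
  have Minf: "Minf $ i $ j = (1 - rinf) * p $ i + (if i = j then rinf else 0)" for i j
    by (simp add: assms(14) spectral_projector_component [OF density assms(7)] mat_def algebra_simps)
  show pos: "mat_pos Minf" if "0 \<le> rinf \<and> rinf < 1"
    using that stationary_density_pos [OF density]
    by (simp add: mat_pos_def Minf add_pos_nonneg)
  show "\<exists>\<gamma>\<^sub>r>0. \<forall>\<gamma>\<ge>\<gamma>\<^sub>r. mat_pos (?R \<gamma>)" if r: "0 \<le> rinf \<and> rinf < 1"
  proof -
    obtain N where "\<forall>\<gamma>\<ge>N. mat_pos (?R \<gamma>)"
      using eventually_mat_pos [OF lim pos [OF r]] by (auto simp: eventually_at_top_linorder)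
    \<comment> \<open>The maximum with 1 makes the threshold positive.\<close>
    then show ?thesis by (intro exI [of _ "max N 1"]) auto
  qed
  show neg: "\<forall>i. p $ i < \<bar>rinf\<bar> / (1 + \<bar>rinf\<bar>) \<longrightarrow> Minf $ i $ i < 0" if "rinf < 0"
    using that by (auto simp: Minf field_simps)
  show "bdd_above {\<gamma>. \<gamma> > 0 \<and> mat_nonneg (?R \<gamma>)}"
    if neg_index: "rinf < 0" "\<exists>i. p $ i < \<bar>rinf\<bar> / (1 + \<bar>rinf\<bar>)"
  proof -
    obtain i where "Minf $ i $ i < 0" using neg neg_index by blast
    from eventually_component_neg [OF lim this] obtain N where "\<forall>\<gamma>\<ge>N. ?R \<gamma> $ i $ i < 0"
      by (auto simp: eventually_at_top_linorder)
    then show ?thesis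
      by (intro bdd_aboveI [of _ N]) (auto simp: mat_nonneg_def, meson linorder_not_less nle_le)
  qed
  show small: "\<forall>\<^sub>F \<gamma> in at_right 0. \<exists>i j. ?R \<gamma> $ i $ j < 0"
    if c: "deriv (rat_fun P Q) 0 = 1 \<and> (\<exists>i j. i \<noteq> j \<and> L $ i $ j < 0)"
  proof -
    obtain i j where ij: "i \<noteq> j" "L $ i $ j < 0" using c by blast
    have "((\<lambda>\<gamma>. (1 / \<gamma>) *\<^sub>R (?R \<gamma> - mat 1)) \<longlongrightarrow> L) (at_right 0)"
      using c by (intro rat_mat_tendsto_at_right_0 coeffs deriv_rat_fun_at_0 [OF assms(11)]) auto
    from eventually_component_neg [OF this ij(2)] eventually_at_right_less [of 0]
    show ?thesis
    proof eventually_elim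
      case (elim \<gamma>)
      \<comment> \<open>Off the diagonal the identity matrix contributes nothing, so the entry has
        the sign of its difference quotient.\<close>
      then have "?R \<gamma> $ i $ j < 0"
        using ij(1) by (simp add: mat_def divide_less_0_iff)
      then show ?case by blast
    qed
  qed
  show "\<exists>\<delta>>0. \<forall>\<gamma>\<in>{\<gamma>. \<gamma> > 0 \<and> mat_nonneg (?R \<gamma>)}. \<delta> \<le> \<gamma>"
    if c: "deriv (rat_fun P Q) 0 = 1 \<and> (\<exists>i j. i \<noteq> j \<and> L $ i $ j < 0)"
  proof -
    obtain \<delta> where "\<delta> > 0" "\<forall>\<gamma>>0. \<gamma> < \<delta> \<longrightarrow> (\<exists>i j. ?R \<gamma> $ i $ j < 0)"
      using small [OF c] by (auto simp: eventually_at_right_field)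
    then show ?thesis
      unfolding mat_nonneg_def by (intro exI [of _ \<delta>]) (auto, meson linorder_not_less)
  qed
qed

end
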